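(* Let $\mathcal{M}=h\mathcal{K}_u$ be a nonzero proper nearly $S^*$-invariant subspace of $H^2$, where $h$ is the extremal function. For $\varphi\in L^\infty(\mathbb{T})$, let $D_\varphi=(I-P_u)M_\varphi|_{\mathcal{K}_u^\perp}$ and $D_\varphi^{\mathcal{M}}=P_{\mathcal{M}^\perp}M_\varphi|_{\mathcal{M}^\perp}$. Then the following statements are equivalent: (1) The pointwise multiplication map $f\mapsto hf$ is well defined on $\mathcal{K}_u^\perp$ and defines a unitary operator $W_h:\mathcal{K}_u^\perp\to\mathcal{M}^\perp$, $W_hf=hf$. (2) The function $h$ is inner. When these conditions hold, $W_h=M_h|_{\mathcal{K}_u^\perp}$ and $$D_\varphi^{\mathcal{M}}W_h=W_hD_\varphi\qquad\text{for all }\varphi\in L^\infty(\mathbb{T}).$$ Thus $W_h$ implements a unitary equivalence between the families $\{D_\varphi^{\mathcal{M}}\}$ and $\{D_\varphi\}$, $\varphi\in L^\infty(\mathbb{T})$.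
   Context: $\mathbb{D}$ is the open unit disk, $\mathbb{T}=\partial\mathbb{D}$, and $L^2(\mathbb{T})$ is taken with respect to normalized Lebesgue measure $m$, with inner product linear in the first variable. $H^2\subset L^2(\mathbb{T})$ is the Hardy space (functions with vanishing negative Fourier coefficients, also viewed as analytic functions on $\mathbb{D}$). For $f\in H^2$, $S^*f=(f-f(0))/z$. For an inner function $u$, $\mathcal{K}_u=H^2\ominus uH^2$, $\mathcal{K}_u^\perp=L^2(\mathbb{T})\ominus\mathcal{K}_u$, and $P_u$ is the orthogonal projection of $L^2(\mathbb{T})$ onto $\mathcal{K}_u$. A closed subspace $\mathcal{M}\subset H^2$ is nearly $S^*$-invariant if $f\in\mathcal{M}$, $f(0)=0$ imply $S^*f\in\mathcal{M}$. In writing $\mathcal{M}=h\mathcal{K}_u$ it is understood that $u$ is a nonconstant inner function with $u(0)=0$ and $h\in\mathcal{M}$ is the extremal function of $\mathcal{M}$: $\|h\|_2=1$, $h(0)>0$, $h\perp\{f\in\mathcal{M}:f(0)=0\}$, and multiplication by $h$ is an isometry from $\mathcal{K}_u$ onto $\mathcal{M}$. $\mathcal{M}^\perp=L^2(\mathbb{T})\ominus\mathcal{M}$, $P_{\mathcal{M}^\perp}$ is the orthogonal projection of $L^2(\mathbb{T})$ onto it, and $M_\varphi$ denotes pointwise multiplication by $\varphi$ on $L^2(\mathbb{T})$. *)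

theory Defs
  imports "HOL-Analysis.Analysis"
begin

section \<open>Functions on the unit circle modulo almost everywhere equality\<close>

text \<open>Normalized Lebesgue measure on the circle, realized as a Borel measure on the complex plane
  carried by the unit circle. Functions are modelled on the whole plane, but the almost everywhere
  classes below only see their values on the circle.\<close>

definition circle_measure :: "complex measure" where
  "circle_measure = distr (uniform_measure lborel {0..2*pi}) borel cis"

lemma sets_circle_measure [measurable_cong, simp]: "sets circle_measure = sets borel"
  and space_circle_measure [simp]: "space circle_measure = UNIV"
  by (simp_all add: circle_measure_def)

lemma measurable_cis_uniform [measurable]:
  "cis \<in> borel_measurable (uniform_measure lborel {0..2*pi})"
proof -
  have "cis \<in> borel_measurable borel"
    by (intro borel_measurable_continuous_onI continuous_intros)
  then show ?thesis by (simp add: measurable_def)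
qed

lemma emeasure_circle_measure_UNIV: "emeasure circle_measure UNIV = 1"
proof -
  have "emeasure (uniform_measure lborel {0..2*pi}) UNIV = 1"
    using emeasure_uniform_measure[of "{0..2*pi}" lborel UNIV]
    by (simp add: ennreal_divide_self)
  then show ?thesis
    unfolding circle_measure_def by (subst emeasure_distr) simp_all
qed

lemma AE_circle_measure_norm: "AE z in circle_measure. cmod z = 1"
  unfolding circle_measure_def by (subst AE_distr_iff) simp_all

lemma measurable_cnj [measurable]: "cnj \<in> borel_measurable borel"
  by (intro borel_measurable_continuous_onI continuous_intros)

lemma measurable_powi [measurable]: "(\<lambda>z::complex. z powi n) \<in> borel_measurable borel"
  unfolding power_int_def by simp

quotient_type circ_fun = "complex \<Rightarrow> complex" / partial:
  "\<lambda>f g. f \<in> borel_measurable circle_measure \<and> g \<in> borel_measurable circle_measure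
     \<and> (AE z in circle_measure. f z = g z)"
proof (rule part_equivpI)
  show "\<exists>f :: complex \<Rightarrow> complex. f \<in> borel_measurable circle_measure \<and> f \<in> borel_measurable circle_measure
      \<and> (AE z in circle_measure. f z = f z)"
    by (rule exI[of _ "\<lambda>_. 0"]) simp
  show "transp (\<lambda>f g :: complex \<Rightarrow> complex. f \<in> borel_measurable circle_measure \<and> g \<in> borel_measurable circle_measure
      \<and> (AE z in circle_measure. f z = g z))"
  proof (rule transpI, elim conjE, intro conjI)
    fix f g h :: "complex \<Rightarrow> complex"
    assume "AE z in circle_measure. f z = g z" "AE z in circle_measure. g z = h z"
    then show "AE z in circle_measure. f z = h z" by eventually_elim simp
  qed
qed (auto simp: symp_def eq_commute)

instantiation circ_fun :: comm_ring_1
begin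

lift_definition zero_circ_fun :: circ_fun is "\<lambda>_. 0" by simp
lift_definition one_circ_fun :: circ_fun is "\<lambda>_. 1" by simp
lift_definition plus_circ_fun :: "circ_fun \<Rightarrow> circ_fun \<Rightarrow> circ_fun" is "\<lambda>f g z. f z + g z" by auto
lift_definition minus_circ_fun :: "circ_fun \<Rightarrow> circ_fun \<Rightarrow> circ_fun" is "\<lambda>f g z. f z - g z" by auto
lift_definition uminus_circ_fun :: "circ_fun \<Rightarrow> circ_fun" is "\<lambda>f z. - f z" by auto
lift_definition times_circ_fun :: "circ_fun \<Rightarrow> circ_fun \<Rightarrow> circ_fun" is "\<lambda>f g z. f z * g z" by auto

instance
proof
  show "(0::circ_fun) \<noteq> 1"
  proof (transfer, clarsimp)
    assume "AE z in circle_measure. False"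
    then have "emeasure circle_measure UNIV = 0"
      using AE_iff_measurable[of UNIV circle_measure "\<lambda>_. False"] by simp
    then show False by (simp add: emeasure_circle_measure_UNIV)
  qed
qed (transfer; simp add: algebra_simps)+

end

lift_definition circ_const :: "complex \<Rightarrow> circ_fun" is "\<lambda>c _. c" by simp

lift_definition circ_Z :: circ_fun is "\<lambda>z. z" by simp

lift_definition circ_divide :: "circ_fun \<Rightarrow> circ_fun \<Rightarrow> circ_fun" is "\<lambda>f g z. f z / g z" by auto

lift_definition square_integrable :: "circ_fun \<Rightarrow> bool" is
  "\<lambda>f. integrable circle_measure (\<lambda>z. (cmod (f z))\<^sup>2)"
  by (rule integrable_cong_AE) auto

lift_definition essentially_bounded :: "circ_fun \<Rightarrow> bool" is
  "\<lambda>f. \<exists>C. AE z in circle_measure. cmod (f z) \<le> C"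
proof (elim conjE, rule iff_exI)
  fix f g :: "complex \<Rightarrow> complex" and C
  assume "AE z in circle_measure. f z = g z"
  then have "AE z in circle_measure. (cmod (f z) \<le> C) = (cmod (g z) \<le> C)"
    by eventually_elim simp
  then show "(AE z in circle_measure. cmod (f z) \<le> C) = (AE z in circle_measure. cmod (g z) \<le> C)"
    by (rule eventually_subst)
qed

lift_definition unimodular :: "circ_fun \<Rightarrow> bool" is
  "\<lambda>f. AE z in circle_measure. cmod (f z) = 1"
proof (elim conjE)
  fix f g :: "complex \<Rightarrow> complex"
  assume "AE z in circle_measure. f z = g z"
  then have "AE z in circle_measure. (cmod (f z) = 1) = (cmod (g z) = 1)"
    by eventually_elim simp
  then show "(AE z in circle_measure. cmod (f z) = 1) = (AE z in circle_measure. cmod (g z) = 1)"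
    by (rule eventually_subst)
qed

text \<open>The inner product of \<open>L\<^sup>2\<close>, linear in the first variable. It is only meaningful on
  square integrable arguments (the integral of a non-integrable function is \<open>0\<close>).\<close>

lift_definition ip :: "circ_fun \<Rightarrow> circ_fun \<Rightarrow> complex" is
  "\<lambda>f g. \<integral>z. f z * cnj (g z) \<partial>circle_measure"
  by (rule integral_cong_AE) (measurable, auto)

lift_definition fourier :: "circ_fun \<Rightarrow> int \<Rightarrow> complex" is
  "\<lambda>f n. \<integral>z. f z * z powi (- n) \<partial>circle_measure"
  by (rule ext, rule integral_cong_AE) (measurable, auto)

section \<open>Lebesgue, Hardy and model spaces\<close>

definition L2 :: "circ_fun set" where
  "L2 = {f. square_integrable f}"

definition Linf :: "circ_fun set" where
  "Linf = {f. essentially_bounded f}"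

definition norm2 :: "circ_fun \<Rightarrow> real" where
  "norm2 f = sqrt (Re (ip f f))"

definition H2 :: "circ_fun set" where
  "H2 = {f \<in> L2. \<forall>n<0. fourier f n = 0}"

text \<open>An element of \<open>H\<^sup>2\<close> viewed as an analytic function on the unit disk, through its
  power series.\<close>

definition disk_ext :: "circ_fun \<Rightarrow> complex \<Rightarrow> complex" where
  "disk_ext f w = (\<Sum>n. fourier f (int n) * w ^ n)"

definition S_star :: "circ_fun \<Rightarrow> circ_fun" where
  "S_star f = circ_divide (f - circ_const (disk_ext f 0)) circ_Z"

text \<open>Inner functions are given by their boundary values.\<close>

definition is_inner :: "circ_fun \<Rightarrow> bool" where
  "is_inner u \<longleftrightarrow> u \<in> H2 \<and> unimodular u"

definition ominus :: "circ_fun set \<Rightarrow> circ_fun set \<Rightarrow> circ_fun set" (infixl "\<ominus>" 65) where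
  "A \<ominus> B = {f \<in> A. \<forall>g\<in>B. ip f g = 0}"

definition model_space :: "circ_fun \<Rightarrow> circ_fun set" where
  "model_space u = H2 \<ominus> ((*) u ` H2)"

definition closed_subspace :: "circ_fun set \<Rightarrow> bool" where
  "closed_subspace M \<longleftrightarrow> M \<subseteq> L2 \<and> 0 \<in> M
     \<and> (\<forall>f\<in>M. \<forall>g\<in>M. f + g \<in> M) \<and> (\<forall>c. \<forall>f\<in>M. circ_const c * f \<in> M)
     \<and> (\<forall>X. \<forall>f\<in>L2. (\<forall>n::nat. X n \<in> M) \<and> (\<lambda>n. norm2 (X n - f)) \<longlonglongrightarrow> 0 \<longrightarrow> f \<in> M)"

definition nearly_S_star_invariant :: "circ_fun set \<Rightarrow> bool" where
  "nearly_S_star_invariant M \<longleftrightarrow> closed_subspace M \<and> M \<subseteq> H2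
     \<and> (\<forall>f\<in>M. disk_ext f 0 = 0 \<longrightarrow> S_star f \<in> M)"

section \<open>Operators\<close>

definition linear_on_set :: "circ_fun set \<Rightarrow> (circ_fun \<Rightarrow> circ_fun) \<Rightarrow> bool" where
  "linear_on_set A T \<longleftrightarrow> (\<forall>f\<in>A. \<forall>g\<in>A. T (f + g) = T f + T g)
     \<and> (\<forall>c. \<forall>f\<in>A. T (circ_const c * f) = circ_const c * T f)"

definition isometry_onto :: "circ_fun set \<Rightarrow> circ_fun set \<Rightarrow> (circ_fun \<Rightarrow> circ_fun) \<Rightarrow> bool" where
  "isometry_onto A B T \<longleftrightarrow> linear_on_set A T \<and> T ` A = B \<and> (\<forall>f\<in>A. norm2 (T f) = norm2 f)"

definition unitary_op :: "circ_fun set \<Rightarrow> circ_fun set \<Rightarrow> (circ_fun \<Rightarrow> circ_fun) \<Rightarrow> bool" where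
  "unitary_op A B T \<longleftrightarrow> linear_on_set A T \<and> bij_betw T A B
     \<and> (\<forall>f\<in>A. \<forall>g\<in>A. ip (T f) (T g) = ip f g)"

text \<open>Orthogonal projection; the description is proper for \<open>f\<close> in \<open>L\<^sup>2\<close> and \<open>M\<close> a closed
  subspace of \<open>L\<^sup>2\<close>.\<close>

definition orth_proj :: "circ_fun set \<Rightarrow> circ_fun \<Rightarrow> circ_fun" where
  "orth_proj M f = (THE g. g \<in> M \<and> (\<forall>k\<in>M. ip (f - g) k = 0))"

definition mult_op :: "circ_fun \<Rightarrow> circ_fun \<Rightarrow> circ_fun" where
  "mult_op \<phi> = (\<lambda>f\<in>L2. \<phi> * f)"

definition W_op :: "circ_fun \<Rightarrow> circ_fun \<Rightarrow> circ_fun \<Rightarrow> circ_fun" where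
  "W_op h u = (\<lambda>f \<in> L2 \<ominus> model_space u. h * f)"

text \<open>The dual truncated Toeplitz operator \<open>D\<^sub>\<phi>\<close> and its analogue for \<open>M\<close>.\<close>

definition D_model :: "circ_fun \<Rightarrow> circ_fun \<Rightarrow> circ_fun \<Rightarrow> circ_fun" where
  "D_model u \<phi> = (\<lambda>f \<in> L2 \<ominus> model_space u. mult_op \<phi> f - orth_proj (model_space u) (mult_op \<phi> f))"

definition D_space :: "circ_fun set \<Rightarrow> circ_fun \<Rightarrow> circ_fun \<Rightarrow> circ_fun" where
  "D_space M \<phi> = (\<lambda>f \<in> L2 \<ominus> M. orth_proj (L2 \<ominus> M) (mult_op \<phi> f))"

definition implements_unitary_equivalence ::
    "circ_fun set \<Rightarrow> circ_fun set \<Rightarrow> (circ_fun \<Rightarrow> circ_fun) \<Rightarrow> 'i set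
     \<Rightarrow> ('i \<Rightarrow> circ_fun \<Rightarrow> circ_fun) \<Rightarrow> ('i \<Rightarrow> circ_fun \<Rightarrow> circ_fun) \<Rightarrow> bool" where
  "implements_unitary_equivalence A B W I S T \<longleftrightarrow> unitary_op A B W
     \<and> (\<forall>i\<in>I. S i ` A \<subseteq> A \<and> T i ` B \<subseteq> B \<and> (\<forall>f\<in>A. T i (W f) = W (S i f)))"

text \<open>The conventions behind the notation \<open>M = h K\<^sub>u\<close>, with \<open>h\<close> the extremal function of \<open>M\<close>.\<close>

definition extremal_representation :: "circ_fun set \<Rightarrow> circ_fun \<Rightarrow> circ_fun \<Rightarrow> bool" where
  "extremal_representation M h u \<longleftrightarrow>
     is_inner u \<and> (\<forall>c. u \<noteq> circ_const c) \<and> disk_ext u 0 = 0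
     \<and> h \<in> M \<and> norm2 h = 1 \<and> disk_ext h 0 \<in> \<real> \<and> 0 < Re (disk_ext h 0)
     \<and> (\<forall>f\<in>M. disk_ext f 0 = 0 \<longrightarrow> ip h f = 0)
     \<and> isometry_onto (model_space u) M (\<lambda>f. h * f)"

end

theory Submission
  imports Defs
begin

text \<open>
  Write \<open>K\<close> for the model space of \<open>u\<close>, so that \<open>M = h K\<close>.

  If \<open>h\<close> is inner, then \<open>\<bar>h\<bar> = 1\<close> almost everywhere and multiplication by \<open>h\<close> is a unitary operator on
  the whole of \<open>L\<^sup>2\<close>. As it maps \<open>K\<close> onto \<open>M\<close>, it maps the complement of \<open>K\<close> onto the complement of \<open>M\<close>
  (\<open>unitary_op_mult_unimodular\<close>) and carries the projection onto \<open>K\<close> to the projection onto \<open>M\<close>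
  (\<open>projection_transport\<close>). Because it commutes with multiplication by \<open>\<phi>\<close>, it also carries the
  compression of \<open>\<phi>\<close> to one complement to the compression to the other. The projections have to
  exist, which is the projection theorem for closed subspaces of \<open>L\<^sup>2\<close> (\<open>projection_exists\<close>); it
  rests on the completeness of \<open>L\<^sup>2\<close> (\<open>fast_Cauchy_square_integrable_limit\<close>).

  Conversely, suppose that multiplication by \<open>h\<close> is isometric on the complement of \<open>K\<close>. That complement
  contains the complement of \<open>H\<^sup>2\<close>, in particular all negative powers of \<open>z\<close>. Comparing the inner
  products of \<open>h z\<^sup>m\<close> and \<open>h z\<^sup>n\<close> with those of \<open>z\<^sup>m\<close> and \<open>z\<^sup>n\<close> for negative \<open>m\<close> and \<open>n\<close> shows that every
  Fourier coefficient of the integrable function \<open>\<bar>h\<bar>\<^sup>2 - 1\<close> vanishes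
  (\<open>unimodular_if_isometric_on_monomials\<close>). An integrable function is determined by its Fourier
  coefficients (\<open>fourier_uniqueness_real\<close>), so \<open>\<bar>h\<bar> = 1\<close>; and \<open>h\<close> lies in \<open>H\<^sup>2\<close>
  because it belongs to \<open>M\<close>.
\<close>

section \<open>Uniqueness of Fourier coefficients\<close>

lemma integrable_circle_bounded:
  fixes f :: "complex \<Rightarrow> 'a::{banach, second_countable_topology}"
  assumes "f \<in> borel_measurable borel" and "AE z in circle_measure. norm (f z) \<le> B"
  shows "integrable circle_measure f"
proof (rule integrableI_bounded_set[where A = UNIV and B = B])
  show "emeasure circle_measure UNIV < \<infinity>" by (simp add: emeasure_circle_measure_UNIV)
qed (use assms in auto)

lemma measure_circle_measure_UNIV: "measure circle_measure UNIV = 1"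
  by (simp add: measure_def emeasure_circle_measure_UNIV)

text \<open>The coefficients are those of an integrable function, not of a square integrable one: the
  predicate is applied to \<open>\<bar>h\<bar>\<^sup>2 - 1\<close>, which is only known to lie in \<open>L\<^sup>1\<close>.\<close>

definition all_fourier_zero :: "(complex \<Rightarrow> complex) \<Rightarrow> bool" where
  "all_fourier_zero w \<longleftrightarrow> integrable circle_measure w
     \<and> (\<forall>n. (\<integral>z. w z * z powi n \<partial>circle_measure) = 0)"

lemma integrable_mult_powi:
  assumes "integrable circle_measure w"
  shows "integrable circle_measure (\<lambda>z. w z * z powi n)"
proof (rule Bochner_Integration.integrable_bound[OF assms])
  show "AE z in circle_measure. norm (w z * z powi n) \<le> norm (w z)"
    using AE_circle_measure_norm
    by eventually_elim (simp add: norm_mult norm_power_int)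
  show "(\<lambda>z. w z * z powi n) \<in> borel_measurable circle_measure"
    using assms by measurable
qed

lemma all_fourier_zero_add:
  assumes "all_fourier_zero v" "all_fourier_zero w"
  shows "all_fourier_zero (\<lambda>z. v z + w z)"
  using assms unfolding all_fourier_zero_def
  by (auto simp: distrib_right integrable_mult_powi)

lemma all_fourier_zero_cmult:
  assumes "all_fourier_zero w"
  shows "all_fourier_zero (\<lambda>z. w z * c)"
  using assms unfolding all_fourier_zero_def
  by (auto simp: mult.assoc mult.left_commute[of _ c])

lemma all_fourier_zero_shift:
  assumes "all_fourier_zero w"
  shows "all_fourier_zero (\<lambda>z. w z * z powi k)"
  unfolding all_fourier_zero_def
proof (intro conjI allI)
  have w: "integrable circle_measure w" using assms by (simp add: all_fourier_zero_def)
  then have [measurable]: "w \<in> borel_measurable borel" by auto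
  show "integrable circle_measure (\<lambda>z. w z * z powi k)"
    using w by (rule integrable_mult_powi)
  fix n
  have "AE z in circle_measure. w z * z powi k * z powi n = w z * z powi (k + n)"
    using AE_circle_measure_norm
  proof eventually_elim
    case (elim z)
    then have "z \<noteq> 0" by auto
    then show ?case by (simp add: power_int_add mult.assoc)
  qed
  then have "(\<integral>z. w z * z powi k * z powi n \<partial>circle_measure)
      = (\<integral>z. w z * z powi (k + n) \<partial>circle_measure)"
    by (intro integral_cong_AE) measurable
  also have "\<dots> = 0" using assms by (simp add: all_fourier_zero_def)
  finally show "(\<integral>z. w z * z powi k * z powi n \<partial>circle_measure) = 0" .
qed

lemma all_fourier_zero_cong_AE:
  assumes "all_fourier_zero v" and [measurable]: "w \<in> borel_measurable borel"
    and eq: "AE z in circle_measure. v z = w z"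
  shows "all_fourier_zero w"
proof -
  have [measurable]: "v \<in> borel_measurable borel"
    using assms(1) by (auto simp: all_fourier_zero_def)
  have "(\<integral>z. v z * z powi n \<partial>circle_measure) = (\<integral>z. w z * z powi n \<partial>circle_measure)" for n
    by (intro integral_cong_AE) (use eq in \<open>measurable, auto\<close>)
  moreover have "integrable circle_measure v \<longleftrightarrow> integrable circle_measure w"
    by (intro integrable_cong_AE) (use eq in \<open>measurable\<close>)
  ultimately show ?thesis using assms(1) by (simp add: all_fourier_zero_def)
qed

lemma cnj_eq_inverse: "cnj z = inverse z" if "cmod z = 1"
proof -
  have "z * cnj z = 1" using complex_norm_square[of z] that by simp
  then show ?thesis by (metis inverse_unique)
qed

text \<open>On the circle \<open>Re z\<close> and \<open>Im z\<close> are the trigonometric polynomials \<open>(z + z\<^sup>-\<^sup>1) / 2\<close> and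
  \<open>(z - z\<^sup>-\<^sup>1) / (2 i)\<close>.\<close>

lemma bounded_linear_on_circle:
  assumes "bounded_linear (f :: complex \<Rightarrow> real)" "cmod z = 1"
  shows "complex_of_real (f z) = z powi 1 * Complex (f 1 / 2) (- f \<i> / 2)
           + z powi (-1) * Complex (f 1 / 2) (f \<i> / 2)"
proof -
  interpret bounded_linear f by fact
  have "f z = f (Re z *\<^sub>R 1 + Im z *\<^sub>R \<i>)" by (rule arg_cong[of _ _ f]) (simp add: complex_eq_iff)
  also have "\<dots> = Re z * f 1 + Im z * f \<i>" by (simp add: add scaleR)
  moreover have "z powi (-1) = cnj z" by (simp add: cnj_eq_inverse[OF assms(2)])
  ultimately show ?thesis
    by (simp add: complex_eq_iff field_simps del: power_int_minus1_right)
qed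

text \<open>Vanishing of all coefficients survives multiplication by \<open>z\<close> and \<open>z\<^sup>-\<^sup>1\<close>, hence by every
  polynomial in \<open>Re z\<close> and \<open>Im z\<close>. Letting \<open>w\<close> vary in the induction makes the product case a mere
  composition, so that no explicit trigonometric sums are needed.\<close>

lemma all_fourier_zero_real_polynomial:
  assumes "real_polynomial_function p" "all_fourier_zero w"
  shows "all_fourier_zero (\<lambda>z. w z * complex_of_real (p z))"
  using assms
proof (induction arbitrary: w)
  case (linear f)
  define a b where "a = Complex (f 1 / 2) (- f \<i> / 2)" and "b = Complex (f 1 / 2) (f \<i> / 2)"
  have [measurable]: "w \<in> borel_measurable borel" "f \<in> borel_measurable borel"
    using linear.prems borel_measurable_continuous_onI[OF linear_continuous_on[OF linear.hyps]]
    by (auto simp: all_fourier_zero_def)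
  show ?case
  proof (rule all_fourier_zero_cong_AE)
    show "all_fourier_zero (\<lambda>z. w z * z powi 1 * a + w z * z powi (-1) * b)"
      using linear.prems
      by (intro all_fourier_zero_add all_fourier_zero_cmult all_fourier_zero_shift)
    show "AE z in circle_measure. w z * z powi 1 * a + w z * z powi (-1) * b
        = w z * complex_of_real (f z)"
      using AE_circle_measure_norm
      by eventually_elim
        (simp only: bounded_linear_on_circle[OF linear.hyps] a_def b_def distrib_left mult.assoc)
  qed simp
next
  case (const c)
  then show ?case by (rule all_fourier_zero_cmult)
next
  case (add f g)
  then show ?case using all_fourier_zero_add by (simp add: distrib_left)
next
  case (mult f g)
  from mult.IH(2)[OF mult.IH(1)[OF mult.prems]] show ?case by (simp add: mult.assoc)
qed

text \<open>Polynomials in \<open>Re z\<close> and \<open>Im z\<close> are uniformly dense in the continuous functions on the circle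
  (Stone--Weierstrass), and the integral against \<open>w\<close> is continuous for the uniform norm.\<close>

lemma integral_mult_continuous_zero:
  fixes w g :: "complex \<Rightarrow> real"
  assumes "all_fourier_zero (\<lambda>z. complex_of_real (w z))" and g: "continuous_on UNIV g"
  shows "(\<integral>z. w z * g z \<partial>circle_measure) = 0"
proof -
  have w: "integrable circle_measure w"
    using assms(1) by (simp add: all_fourier_zero_def complex_of_real_integrable_eq)
  then have [measurable]: "w \<in> borel_measurable borel" by auto
  have [measurable]: "g \<in> borel_measurable borel"
    using g by (rule borel_measurable_continuous_onI)
  define B where "B = (\<integral>z. \<bar>w z\<bar> \<partial>circle_measure)"
  have B: "0 \<le> B" unfolding B_def by simp
  have bound: "\<bar>\<integral>z. w z * g z \<partial>circle_measure\<bar> \<le> e * B" if e: "0 < e" for e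
  proof -
    have "continuous_on (sphere 0 1) g" using g by (rule continuous_on_subset) simp
    then obtain p where p: "real_polynomial_function p"
        and close: "\<And>z. z \<in> sphere 0 1 \<Longrightarrow> \<bar>g z - p z\<bar> < e"
      using Stone_Weierstrass_real_polynomial_function[of "sphere 0 1" g e] e by auto
    have [measurable]: "p \<in> borel_measurable borel"
      using p by (intro borel_measurable_continuous_onI continuous_on_polymonial_function)
        (simp add: real_polynomial_function_eq)
    from all_fourier_zero_real_polynomial[OF p assms(1)]
    have wp: "all_fourier_zero (\<lambda>z. complex_of_real (w z * p z))" by simp
    then have wp_int: "integrable circle_measure (\<lambda>z. w z * p z)"
      unfolding all_fourier_zero_def by (simp only: complex_of_real_integrable_eq)
    have "(\<integral>z. complex_of_real (w z * p z) * z powi 0 \<partial>circle_measure) = 0"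
      using wp by (simp only: all_fourier_zero_def)
    then have "(\<integral>z. complex_of_real (w z * p z) \<partial>circle_measure) = 0" by simp
    then have wp_zero: "(\<integral>z. w z * p z \<partial>circle_measure) = 0"
      by (simp only: integral_complex_of_real of_real_eq_0_iff)
    have le: "AE z in circle_measure. norm (w z * (g z - p z)) \<le> e * \<bar>w z\<bar>"
      using AE_circle_measure_norm
    proof eventually_elim
      case (elim z)
      then show ?case using close[of z] mult_left_mono[of "\<bar>g z - p z\<bar>" e "\<bar>w z\<bar>"]
        by (simp add: abs_mult mult.commute)
    qed
    have diff: "integrable circle_measure (\<lambda>z. w z * (g z - p z))"
      by (rule Bochner_Integration.integrable_bound[of _ "\<lambda>z. e * \<bar>w z\<bar>"])
        (use w le e in \<open>auto simp: abs_mult\<close>)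
    have "(\<integral>z. w z * g z \<partial>circle_measure)
        = (\<integral>z. w z * (g z - p z) + w z * p z \<partial>circle_measure)"
      by (simp add: algebra_simps)
    also have "\<dots> = (\<integral>z. w z * (g z - p z) \<partial>circle_measure)"
      using diff wp_int wp_zero by simp
    also have "\<bar>\<dots>\<bar> \<le> (\<integral>z. norm (w z * (g z - p z)) \<partial>circle_measure)"
      using integral_norm_bound[of circle_measure "\<lambda>z. w z * (g z - p z)"] by simp
    also have "\<dots> \<le> (\<integral>z. e * \<bar>w z\<bar> \<partial>circle_measure)"
      using diff w le by (intro integral_mono_AE) auto
    finally show ?thesis by (simp add: B_def)
  qed
  have "\<bar>\<integral>z. w z * g z \<partial>circle_measure\<bar> \<le> 0"
  proof (rule field_le_epsilon)
    fix e :: real assume "0 < e"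
    then have "\<bar>\<integral>z. w z * g z \<partial>circle_measure\<bar> \<le> e / (B + 1) * B" using B by (intro bound) simp
    also have "\<dots> \<le> e" using B \<open>0 < e\<close> by (simp add: field_simps)
    finally show "\<bar>\<integral>z. w z * g z \<partial>circle_measure\<bar> \<le> 0 + e" by simp
  qed
  then show ?thesis by simp
qed

text \<open>The indicator of a closed set is the pointwise limit of the continuous functions
  \<open>max 0 (1 - n dist(z, C))\<close>.\<close>

lemma integral_mult_indicator_closed_zero:
  fixes w :: "complex \<Rightarrow> real"
  assumes "all_fourier_zero (\<lambda>z. complex_of_real (w z))" and C: "closed C"
  shows "(\<integral>z. w z * indicator C z \<partial>circle_measure) = 0"
proof (cases "C = {}")
  case False
  have w: "integrable circle_measure w"
    using assms(1) by (simp add: all_fourier_zero_def complex_of_real_integrable_eq)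
  then have [measurable]: "w \<in> borel_measurable borel" by auto
  have [measurable]: "C \<in> sets borel" using C by simp
  define g where "g = (\<lambda>(n::nat) z. max 0 (1 - real n * infdist z C))"
  have cont: "continuous_on UNIV (g n)" for n
    unfolding g_def by (intro continuous_intros)
  then have [measurable]: "g n \<in> borel_measurable borel" for n
    by (rule borel_measurable_continuous_onI)
  have lim: "(\<lambda>n. g n z) \<longlonglongrightarrow> indicator C z" for z
  proof (cases "z \<in> C")
    case True
    then show ?thesis by (simp add: g_def)
  next
    case outside: False
    then have pos: "0 < infdist z C" using C False by (simp add: infdist_pos_not_in_closed)
    then obtain N where N: "1 < real N * infdist z C" using reals_Archimedean3 by blast
    have "g n z = 0" if "n \<ge> N" for n
    proof -
      have "real N * infdist z C \<le> real n * infdist z C" using that pos by simp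
      then show ?thesis using N by (simp add: g_def)
    qed
    then have "\<forall>\<^sub>F n in sequentially. g n z = indicator C z"
      using outside by (auto simp: eventually_sequentially)
    then show ?thesis by (rule tendsto_eventually)
  qed
  have "(\<lambda>n. \<integral>z. w z * g n z \<partial>circle_measure) \<longlonglongrightarrow> (\<integral>z. w z * indicator C z \<partial>circle_measure)"
  proof (rule integral_dominated_convergence[where w = "\<lambda>z. \<bar>w z\<bar>"])
    show "AE z in circle_measure. (\<lambda>n. w z * g n z) \<longlonglongrightarrow> w z * indicator C z"
      using lim by (intro AE_I2 tendsto_mult tendsto_const)
    show "AE z in circle_measure. norm (w z * g n z) \<le> \<bar>w z\<bar>" for n
    proof (rule AE_I2)
      fix z
      have "\<bar>g n z\<bar> \<le> 1" by (auto simp: g_def infdist_nonneg)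
      then show "norm (w z * g n z) \<le> \<bar>w z\<bar>"
        by (simp add: abs_mult mult_left_le)
    qed
  qed (use w in auto)
  then show ?thesis
    by (simp add: integral_mult_continuous_zero[OF assms(1) cont] LIMSEQ_const_iff)
qed simp

text \<open>Closed sets form an intersection-stable generator of the Borel sets, so \<open>w\<close> integrates to zero
  over every Borel set.\<close>

lemma fourier_uniqueness_real:
  fixes w :: "complex \<Rightarrow> real"
  assumes "all_fourier_zero (\<lambda>z. complex_of_real (w z))"
  shows "AE z in circle_measure. w z = 0"
proof -
  have w: "integrable circle_measure w"
    using assms(1) by (simp add: all_fourier_zero_def complex_of_real_integrable_eq)
  then have [measurable]: "w \<in> borel_measurable borel" by auto
  have si: "set_integrable circle_measure E w" if "E \<in> sets borel" for E
    unfolding set_integrable_def using w that by (intro integrable_mult_indicator) auto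
  have closed_zero: "(LINT z:C|circle_measure. w z) = 0" if "closed C" for C
    using integral_mult_indicator_closed_zero[OF assms that]
    by (simp add: set_lebesgue_integral_def mult.commute)
  have zero: "(LINT z:E|circle_measure. w z) = 0" if "E \<in> sigma_sets UNIV (Collect closed)" for E
  proof (rule sigma_sets_induct_disjoint[OF _ _ that])
    fix E :: "complex set"
    assume compl: "E \<in> sigma_sets UNIV (Collect closed)" "(LINT z:E|circle_measure. w z) = 0"
    have E: "E \<in> sets borel" using compl by (simp add: borel_eq_closed)
    have "(LINT z:E \<union> (UNIV - E)|circle_measure. w z)
        = (LINT z:E|circle_measure. w z) + (LINT z:UNIV - E|circle_measure. w z)"
      by (rule set_integral_Un) (use E si in auto)
    then show "(LINT z:UNIV - E|circle_measure. w z) = 0"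
      using compl closed_zero[of UNIV] by simp
  next
    fix E :: "nat \<Rightarrow> complex set"
    assume union: "disjoint_family E" "range E \<subseteq> sigma_sets UNIV (Collect closed)"
      "\<And>i. (LINT z:E i|circle_measure. w z) = 0"
    have E: "E i \<in> sets borel" for i using union(2) by (auto simp: borel_eq_closed)
    have "(LINT z:(\<Union>i. E i)|circle_measure. w z) = (\<Sum>i. LINT z:E i|circle_measure. w z)"
      using union(1) E by (intro lebesgue_integral_countable_add si)
        (auto simp: disjoint_family_on_def)
    then show "(LINT z:(\<Union>i. E i)|circle_measure. w z) = 0" using union(3) by simp
  qed (auto simp: Int_stable_def closed_zero)
  have "AE z in circle_measure. w z = (\<lambda>_. 0) z"
  proof (rule density_unique_real)
    fix E assume "E \<in> sets circle_measure"
    then have "E \<in> sigma_sets UNIV (Collect closed)" by (simp add: borel_eq_closed)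
    then show "(LINT z:E|circle_measure. w z) = (LINT z:E|circle_measure. 0)"
      using zero by (simp add: set_lebesgue_integral_def)
  qed (use w in auto)
  then show ?thesis by simp
qed

section \<open>Completeness of the square integrable functions\<close>

lemma integrable_of_integrable_square:
  fixes f :: "complex \<Rightarrow> complex"
  assumes [measurable]: "f \<in> borel_measurable borel"
    and sq: "integrable circle_measure (\<lambda>z. (cmod (f z))\<^sup>2)"
  shows "integrable circle_measure f"
proof (rule Bochner_Integration.integrable_bound)
  show "integrable circle_measure (\<lambda>z. 1 + (cmod (f z))\<^sup>2)"
    using sq integrable_circle_bounded[of "\<lambda>_. 1 :: real" 1] by simp
  show "AE z in circle_measure. norm (f z) \<le> norm (1 + (cmod (f z))\<^sup>2)"
  proof (rule AE_I2)
    fix z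
    have "0 \<le> (cmod (f z) - 1)\<^sup>2" by simp
    then have "2 * cmod (f z) \<le> 1 + (cmod (f z))\<^sup>2" by (simp add: power2_eq_square algebra_simps)
    then show "norm (f z) \<le> norm (1 + (cmod (f z))\<^sup>2)" by (auto intro: order_trans[rotated])
  qed
qed simp

text \<open>The \<open>L\<^sup>1\<close> norm is at most the \<open>L\<^sup>2\<close> norm on a probability space; integrating
  \<open>2 s \<bar>f\<bar> \<le> s\<^sup>2 + \<bar>f\<bar>\<^sup>2\<close> gives it directly.\<close>

lemma integral_norm_le_of_square:
  fixes f :: "complex \<Rightarrow> complex"
  assumes [measurable]: "f \<in> borel_measurable borel"
    and sq: "integrable circle_measure (\<lambda>z. (cmod (f z))\<^sup>2)"
    and le: "(\<integral>z. (cmod (f z))\<^sup>2 \<partial>circle_measure) \<le> s\<^sup>2" and s: "0 < s"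
  shows "(\<integral>z. cmod (f z) \<partial>circle_measure) \<le> s"
proof -
  have const: "integrable circle_measure (\<lambda>z. s)" by (rule integrable_circle_bounded[of _ s]) (use s in auto)
  have "cmod (f z) \<le> (s + (cmod (f z))\<^sup>2 / s) / 2" for z
  proof -
    have "0 \<le> (cmod (f z) - s)\<^sup>2" by simp
    then have "2 * s * cmod (f z) \<le> s\<^sup>2 + (cmod (f z))\<^sup>2" by (simp add: power2_eq_square algebra_simps)
    then show ?thesis using s by (simp add: field_simps power2_eq_square)
  qed
  then have "(\<integral>z. cmod (f z) \<partial>circle_measure) \<le> (\<integral>z. (s + (cmod (f z))\<^sup>2 / s) / 2 \<partial>circle_measure)"
    using sq const integrable_of_integrable_square[OF assms(1) sq] by (intro integral_mono) auto
  also have "\<dots> = (s + (\<integral>z. (cmod (f z))\<^sup>2 \<partial>circle_measure) / s) / 2"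
    using sq const by (simp add: measure_circle_measure_UNIV)
  also have "\<dots> \<le> (s + s\<^sup>2 / s) / 2" using le s by (simp add: divide_right_mono)
  also have "\<dots> = s" using s by (simp add: power2_eq_square)
  finally show ?thesis .
qed

text \<open>The Riesz--Fischer argument. The increments have summable \<open>L\<^sup>1\<close> norms, so the sequence converges
  almost everywhere, and Fatou's lemma carries the \<open>L\<^sup>2\<close> bounds over to the limit. The minimizing
  sequences of the projection theorem can be chosen to converge at a geometric rate, which is why
  such a rate is assumed and no subsequence is extracted.\<close>

lemma fast_Cauchy_square_integrable_limit:
  fixes F :: "nat \<Rightarrow> complex \<Rightarrow> complex"
  assumes [measurable]: "\<And>n. F n \<in> borel_measurable borel"
    and int: "\<And>m n. integrable circle_measure (\<lambda>z. (cmod (F m z - F n z))\<^sup>2)"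
    and bound: "\<And>m n. n \<le> m \<Longrightarrow> (\<integral>z. (cmod (F m z - F n z))\<^sup>2 \<partial>circle_measure) \<le> (1/4) ^ n"
  obtains G where "G \<in> borel_measurable borel"
    and "\<And>n. integrable circle_measure (\<lambda>z. (cmod (F n z - G z))\<^sup>2)"
    and "\<And>n. (\<integral>z. (cmod (F n z - G z))\<^sup>2 \<partial>circle_measure) \<le> (1/4) ^ n"
proof -
  define G where "G = (\<lambda>z. lim (\<lambda>n. F n z))"
  have meas [measurable]: "G \<in> borel_measurable borel" unfolding G_def by measurable
  have step: "(\<integral>\<^sup>+z. ennreal (cmod (F (Suc n) z - F n z)) \<partial>circle_measure) \<le> ennreal ((1/2) ^ n)" for n
  proof -
    have "(\<integral>z. (cmod (F (Suc n) z - F n z))\<^sup>2 \<partial>circle_measure) \<le> ((1/2) ^ n)\<^sup>2"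
      using bound[of n "Suc n"] by (simp add: power2_eq_square power_mult_distrib[symmetric])
    then have "(\<integral>z. cmod (F (Suc n) z - F n z) \<partial>circle_measure) \<le> (1/2) ^ n"
      using int by (intro integral_norm_le_of_square) auto
    then show ?thesis
      using integrable_of_integrable_square[OF _ int]
      by (subst nn_integral_eq_integral) (auto intro: ennreal_leI)
  qed
  have "(\<integral>\<^sup>+z. (\<Sum>n. ennreal (cmod (F (Suc n) z - F n z))) \<partial>circle_measure)
      = (\<Sum>n. \<integral>\<^sup>+z. ennreal (cmod (F (Suc n) z - F n z)) \<partial>circle_measure)"
    by (rule nn_integral_suminf) measurable
  also have "\<dots> \<le> (\<Sum>n. ennreal ((1/2) ^ n))" using step by (intro suminf_le) auto
  also have "\<dots> < \<infinity>" 
    using summable_geometric[of "1/2 :: real"] by (simp add: suminf_ennreal_eq[OF _ summable_sums] )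
  finally have "AE z in circle_measure. (\<Sum>n. ennreal (cmod (F (Suc n) z - F n z))) \<noteq> \<infinity>"
    by (intro nn_integral_PInf_AE) auto
  then have lim: "AE z in circle_measure. (\<lambda>n. F n z) \<longlonglongrightarrow> G z"
  proof eventually_elim
    case (elim z)
    then have "summable (\<lambda>n. cmod (F (Suc n) z - F n z))"
      by (intro summable_suminf_not_top) auto
    then have "summable (\<lambda>n. F (Suc n) z - F n z)" by (rule summable_norm_cancel)
    then have "convergent (\<lambda>n. F n z)" 
      using sum_lessThan_telescope[of "\<lambda>n. F n z"]
      by (simp add: summable_iff_convergent convergent_diff_const_right_iff)
    then show ?case by (simp add: G_def convergent_LIMSEQ_iff)
  qed
  have fatou: "(\<integral>\<^sup>+z. ennreal ((cmod (F n z - G z))\<^sup>2) \<partial>circle_measure) \<le> ennreal ((1/4) ^ n)" for n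
  proof -
    have "AE z in circle_measure. ennreal ((cmod (F n z - G z))\<^sup>2)
        = liminf (\<lambda>m. ennreal ((cmod (F m z - F n z))\<^sup>2))"
      using lim
    proof eventually_elim
      case (elim z)
      have "(\<lambda>m. ennreal ((cmod (F m z - F n z))\<^sup>2)) \<longlonglongrightarrow> ennreal ((cmod (G z - F n z))\<^sup>2)"
        using elim by (intro tendsto_intros)
      from lim_imp_Liminf[OF sequentially_bot this] show ?case by (simp add: norm_minus_commute)
    qed
    then have "(\<integral>\<^sup>+z. ennreal ((cmod (F n z - G z))\<^sup>2) \<partial>circle_measure)
        = (\<integral>\<^sup>+z. liminf (\<lambda>m. ennreal ((cmod (F m z - F n z))\<^sup>2)) \<partial>circle_measure)"
      by (rule nn_integral_cong_AE)
    also have "\<dots> \<le> liminf (\<lambda>m. \<integral>\<^sup>+z. ennreal ((cmod (F m z - F n z))\<^sup>2) \<partial>circle_measure)"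
      by (rule nn_integral_liminf) measurable
    also have "\<dots> \<le> ennreal ((1/4) ^ n)"
    proof (rule Liminf_le)
      have "(\<integral>\<^sup>+z. ennreal ((cmod (F m z - F n z))\<^sup>2) \<partial>circle_measure) \<le> ennreal ((1/4) ^ n)"
        if "n \<le> m" for m
        using bound[OF that] int by (subst nn_integral_eq_integral) (auto intro: ennreal_leI)
      then show "\<forall>\<^sub>F m in sequentially. (\<integral>\<^sup>+z. ennreal ((cmod (F m z - F n z))\<^sup>2) \<partial>circle_measure)
          \<le> ennreal ((1/4) ^ n)"
        by (auto simp: eventually_sequentially)
    qed simp
    finally show ?thesis .
  qed
  have intG: "integrable circle_measure (\<lambda>z. (cmod (F n z - G z))\<^sup>2)" for n
  proof (rule integrableI_bounded)
    show "(\<integral>\<^sup>+z. ennreal (norm ((cmod (F n z - G z))\<^sup>2)) \<partial>circle_measure) < \<infinity>"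
      using le_less_trans[OF fatou[of n]] by simp
  qed simp
  moreover have "(\<integral>z. (cmod (F n z - G z))\<^sup>2 \<partial>circle_measure) \<le> (1/4) ^ n" for n
    using fatou[of n] intG[of n] by (subst (asm) nn_integral_eq_integral) auto
  ultimately show thesis using meas that by blast
qed

section \<open>The inner product space of square integrable classes\<close>

lemma circ_fun_representative:
  obtains F where "F \<in> borel_measurable borel" and "f = abs_circ_fun F"
  using Quotient_abs_rep[OF Quotient_circ_fun, of f] Quotient_rep_reflp[OF Quotient_circ_fun, of f]
  by (metis measurable_cong_sets sets_circle_measure)

lemma integrable_mult_cnj:
  assumes [measurable]: "f \<in> borel_measurable borel" "g \<in> borel_measurable borel"
    and "integrable circle_measure (\<lambda>z. (cmod (f z))\<^sup>2)"
    and "integrable circle_measure (\<lambda>z. (cmod (g z))\<^sup>2)"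
  shows "integrable circle_measure (\<lambda>z. f z * cnj (g z))"
proof (rule Bochner_Integration.integrable_bound)
  show "integrable circle_measure (\<lambda>z. (cmod (f z))\<^sup>2 + (cmod (g z))\<^sup>2)"
    using assms by simp
  show "AE z in circle_measure. norm (f z * cnj (g z)) \<le> norm ((cmod (f z))\<^sup>2 + (cmod (g z))\<^sup>2)"
  proof (rule AE_I2)
    fix z
    have "0 \<le> (cmod (f z) - cmod (g z))\<^sup>2" by simp
    then have "2 * (cmod (f z) * cmod (g z)) \<le> (cmod (f z))\<^sup>2 + (cmod (g z))\<^sup>2"
      by (simp add: power2_eq_square algebra_simps)
    moreover have "0 \<le> cmod (f z) * cmod (g z)" by simp
    ultimately show "norm (f z * cnj (g z)) \<le> norm ((cmod (f z))\<^sup>2 + (cmod (g z))\<^sup>2)"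
      unfolding norm_mult complex_mod_cnj real_norm_def by linarith
  qed
qed measurable

lemma L2_mult_Linf:
  assumes "\<phi> \<in> Linf" "f \<in> L2"
  shows "\<phi> * f \<in> L2"
  using assms unfolding L2_def Linf_def mem_Collect_eq
proof (transfer, elim conjE exE)
  fix \<phi> f :: "complex \<Rightarrow> complex" and C
  assume [measurable]: "\<phi> \<in> borel_measurable circle_measure" "f \<in> borel_measurable circle_measure"
    and C: "AE z in circle_measure. cmod (\<phi> z) \<le> C"
    and f: "integrable circle_measure (\<lambda>z. (cmod (f z))\<^sup>2)"
  show "integrable circle_measure (\<lambda>z. (cmod (\<phi> z * f z))\<^sup>2)"
  proof (rule Bochner_Integration.integrable_bound)
    show "integrable circle_measure (\<lambda>z. C\<^sup>2 * (cmod (f z))\<^sup>2)" using f by simp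
    show "AE z in circle_measure. norm ((cmod (\<phi> z * f z))\<^sup>2) \<le> norm (C\<^sup>2 * (cmod (f z))\<^sup>2)"
      using C
      by eventually_elim
        (auto simp: norm_mult power_mult_distrib intro!: mult_right_mono power_mono)
  qed measurable
qed

lemma L2_add:
  assumes "f \<in> L2" "g \<in> L2"
  shows "f + g \<in> L2"
  using assms unfolding L2_def mem_Collect_eq
proof (transfer, elim conjE)
  fix f g :: "complex \<Rightarrow> complex"
  assume [measurable]: "f \<in> borel_measurable circle_measure" "g \<in> borel_measurable circle_measure"
    and f: "integrable circle_measure (\<lambda>z. (cmod (f z))\<^sup>2)"
    and g: "integrable circle_measure (\<lambda>z. (cmod (g z))\<^sup>2)"
  show "integrable circle_measure (\<lambda>z. (cmod (f z + g z))\<^sup>2)"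
  proof (rule Bochner_Integration.integrable_bound)
    show "integrable circle_measure (\<lambda>z. 2 * (cmod (f z))\<^sup>2 + 2 * (cmod (g z))\<^sup>2)"
      using f g by simp
    show "AE z in circle_measure. norm ((cmod (f z + g z))\<^sup>2)
        \<le> norm (2 * (cmod (f z))\<^sup>2 + 2 * (cmod (g z))\<^sup>2)"
    proof (rule AE_I2)
      fix z
      have "(cmod (f z + g z))\<^sup>2 \<le> (cmod (f z) + cmod (g z))\<^sup>2"
        by (simp add: norm_triangle_ineq power_mono)
      moreover have "0 \<le> (cmod (f z) - cmod (g z))\<^sup>2" by simp
      ultimately show "norm ((cmod (f z + g z))\<^sup>2) \<le> norm (2 * (cmod (f z))\<^sup>2 + 2 * (cmod (g z))\<^sup>2)"
        by (simp add: power2_sum power2_diff)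
    qed
  qed measurable
qed

lemma circ_const_Linf: "circ_const c \<in> Linf"
  unfolding Linf_def mem_Collect_eq by transfer blast

lemma circ_const_mult: "circ_const (a * b) = circ_const a * circ_const b" by transfer simp
lemma circ_const_one: "circ_const 1 = 1" by transfer simp
lemma circ_const_minus_one: "circ_const (- 1) * f = - f" by transfer simp

lemma L2_cmult: "f \<in> L2 \<Longrightarrow> circ_const c * f \<in> L2"
  by (rule L2_mult_Linf[OF circ_const_Linf])

lemma L2_diff: "f \<in> L2 \<Longrightarrow> g \<in> L2 \<Longrightarrow> f - g \<in> L2"
  using L2_add[of f "- g"] L2_cmult[of g "-1"] by (simp add: circ_const_minus_one)

lemma ip_add_left:
  assumes "f \<in> L2" "g \<in> L2" "k \<in> L2"
  shows "ip (f + g) k = ip f k + ip g k"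
  using assms unfolding L2_def mem_Collect_eq
  by (transfer, clarsimp simp: distrib_right) (simp add: integrable_mult_cnj)

lemma ip_cmult_left: "ip (circ_const c * f) k = c * ip f k"
  by transfer (simp add: mult.assoc)

lemma ip_commute: "ip g f = cnj (ip f g)"
proof (transfer, clarsimp)
  fix f g :: "complex \<Rightarrow> complex"
  show "(\<integral>z. g z * cnj (f z) \<partial>circle_measure) = cnj (\<integral>z. f z * cnj (g z) \<partial>circle_measure)"
    using Bochner_Integration.integral_cnj[of circle_measure "\<lambda>z. f z * cnj (g z)"]
    by (simp add: mult.commute)
qed

lemma ip_diff_left:
  assumes "f \<in> L2" "g \<in> L2" "k \<in> L2"
  shows "ip (f - g) k = ip f k - ip g k"
  using ip_add_left[of f "circ_const (-1) * g" k] assms L2_cmult[of g "-1"]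
  by (simp add: ip_cmult_left) (simp add: circ_const_minus_one)

lemma ip_diff_right:
  assumes "f \<in> L2" "g \<in> L2" "k \<in> L2"
  shows "ip k (f - g) = ip k f - ip k g"
  using ip_diff_left[OF assms] by (metis complex_cnj_diff ip_commute)

lemma ip_add_right:
  assumes "f \<in> L2" "g \<in> L2" "k \<in> L2"
  shows "ip k (f + g) = ip k f + ip k g"
  using ip_add_left[OF assms] by (metis complex_cnj_add ip_commute)

lemma ip_cmult_right: "ip k (circ_const c * f) = cnj c * ip k f"
  using ip_cmult_left by (metis complex_cnj_mult ip_commute)

lemma ip_self_integral:
  assumes [measurable]: "F \<in> borel_measurable borel"
  shows "ip (abs_circ_fun F) (abs_circ_fun F)
    = complex_of_real (\<integral>z. (cmod (F z))\<^sup>2 \<partial>circle_measure)"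
proof -
  have "ip (abs_circ_fun F) (abs_circ_fun F) = (\<integral>z. F z * cnj (F z) \<partial>circle_measure)"
    by (simp add: ip.abs_eq)
  also have "\<dots> = (\<integral>z. complex_of_real ((cmod (F z))\<^sup>2) \<partial>circle_measure)"
    by (simp only: complex_norm_square)
  finally show ?thesis by (simp only: integral_complex_of_real)
qed

lemma norm2_square_integral:
  assumes "F \<in> borel_measurable borel"
  shows "(norm2 (abs_circ_fun F))\<^sup>2 = (\<integral>z. (cmod (F z))\<^sup>2 \<partial>circle_measure)"
  unfolding norm2_def ip_self_integral[OF assms] by simp

lemma ip_self: "ip f f = complex_of_real ((norm2 f)\<^sup>2)"
proof -
  obtain F where "F \<in> borel_measurable borel" "f = abs_circ_fun F"
    by (rule circ_fun_representative)
  then show ?thesis by (simp only: norm2_square_integral ip_self_integral)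
qed

lemma norm2_cmult_square: "(norm2 (circ_const c * f))\<^sup>2 = (cmod c)\<^sup>2 * (norm2 f)\<^sup>2"
proof -
  have "complex_of_real ((norm2 (circ_const c * f))\<^sup>2) = (c * cnj c) * ip f f"
    unfolding ip_self[symmetric] ip_cmult_left ip_cmult_right by (simp only: mult_ac)
  also have "\<dots> = complex_of_real ((cmod c)\<^sup>2 * (norm2 f)\<^sup>2)"
    by (simp add: ip_self complex_norm_square[symmetric])
  finally show ?thesis by (simp only: of_real_eq_iff)
qed

lemma norm2_diff_square:
  assumes "x \<in> L2" "y \<in> L2"
  shows "(norm2 (x - y))\<^sup>2 = (norm2 x)\<^sup>2 - 2 * Re (ip x y) + (norm2 y)\<^sup>2"
proof -
  have "ip (x - y) (x - y) = ip x x - ip x y - cnj (ip x y) + ip y y"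
    using assms ip_commute[of x y] by (simp add: ip_diff_left ip_diff_right L2_diff)
  then have "Re (ip (x - y) (x - y)) = Re (ip x x) - 2 * Re (ip x y) + Re (ip y y)" by simp
  then show ?thesis by (simp add: ip_self)
qed

lemma norm2_add_square:
  assumes "x \<in> L2" "y \<in> L2"
  shows "(norm2 (x + y))\<^sup>2 = (norm2 x)\<^sup>2 + 2 * Re (ip x y) + (norm2 y)\<^sup>2"
proof -
  have "ip (x + y) (x + y) = ip x x + ip x y + cnj (ip x y) + ip y y"
    using assms ip_commute[of x y] by (simp add: ip_add_left ip_add_right L2_add)
  then have "Re (ip (x + y) (x + y)) = Re (ip x x) + 2 * Re (ip x y) + Re (ip y y)" by simp
  then show ?thesis by (simp add: ip_self)
qed

text \<open>If subtracting multiples of \<open>k\<close> can hardly shorten \<open>x\<close>, then \<open>x\<close> is nearly orthogonal to \<open>k\<close>: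
  minimize the quadratic \<open>t \<mapsto> \<parallel>x - t \<langle>x, k\<rangle> k\<parallel>\<^sup>2\<close>. The case \<open>d = 0\<close> is the
  Cauchy--Schwarz inequality; with \<open>d\<close> the squared distance to a subspace it shows that the
  residuals of a minimizing sequence become orthogonal to the subspace.\<close>

lemma ip_square_le_of_distance:
  assumes x: "x \<in> L2" and k: "k \<in> L2"
    and d: "\<And>c. d \<le> (norm2 (x - circ_const c * k))\<^sup>2"
  shows "(cmod (ip x k))\<^sup>2 \<le> ((norm2 x)\<^sup>2 - d) * (norm2 k)\<^sup>2"
proof -
  define p N where "p = ip x k" and "N = (norm2 k)\<^sup>2"
  have scaled: "2 * t * (cmod p)\<^sup>2 - t\<^sup>2 * (cmod p)\<^sup>2 * N \<le> (norm2 x)\<^sup>2 - d" for t :: real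
  proof -
    have "ip x (circ_const (of_real t * p) * k) = of_real (t * (cmod p)\<^sup>2)"
      unfolding ip_cmult_right p_def[symmetric] of_real_mult complex_norm_square
        complex_cnj_mult complex_cnj_complex_of_real
      by (simp only: mult_ac)
    then have "(norm2 (x - circ_const (of_real t * p) * k))\<^sup>2
        = (norm2 x)\<^sup>2 - 2 * (t * (cmod p)\<^sup>2) + t\<^sup>2 * (cmod p)\<^sup>2 * N"
      unfolding norm2_diff_square[OF x L2_cmult[OF k]] norm2_cmult_square N_def
      by (simp add: norm_mult power_mult_distrib)
    then show ?thesis using d[of "of_real t * p"] by (simp add: algebra_simps)
  qed
  show ?thesis
  proof (cases "N = 0")
    case True
    have "p = 0"
    proof (rule ccontr)
      assume "p \<noteq> 0"
      then have pos: "0 < (cmod p)\<^sup>2" by simp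
      \<comment> \<open>When \<open>k\<close> has norm zero the quadratic is linear in \<open>t\<close>; this \<open>t\<close> overshoots its bound by one.\<close>
      then show False
        using scaled[of "(((norm2 x)\<^sup>2 - d) + 1) / (2 * (cmod p)\<^sup>2)"] True by (simp add: field_simps)
    qed
    then show ?thesis using True by (simp add: p_def N_def)
  next
    case False
    then have pos: "0 < N" by (simp add: N_def)
    have "2 * (1 / N) * (cmod p)\<^sup>2 - (1 / N)\<^sup>2 * (cmod p)\<^sup>2 * N = (cmod p)\<^sup>2 / N"
      using pos by (simp add: field_simps power2_eq_square)
    then have "(cmod p)\<^sup>2 / N \<le> (norm2 x)\<^sup>2 - d" using scaled[of "1 / N"] by simp
    then show ?thesis using pos by (simp add: p_def N_def field_simps)
  qed
qed

lemma cauchy_schwarz: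
  assumes "x \<in> L2" "k \<in> L2"
  shows "(cmod (ip x k))\<^sup>2 \<le> (norm2 x)\<^sup>2 * (norm2 k)\<^sup>2"
  using ip_square_le_of_distance[OF assms, of 0] by simp

lemma parallelogram_midpoint:
  assumes "f \<in> L2" "p \<in> L2" "q \<in> L2"
  shows "(norm2 (p - q))\<^sup>2 = 2 * (norm2 (f - p))\<^sup>2 + 2 * (norm2 (f - q))\<^sup>2
           - 4 * (norm2 (f - circ_const (1/2) * (p + q)))\<^sup>2"
proof -
  have two: "circ_const 2 = 1 + 1" by transfer simp
  have "circ_const 2 * (circ_const (1/2) * (p + q)) = p + q"
    by (simp add: mult.assoc[symmetric] circ_const_mult[symmetric] circ_const_one)
  then have "circ_const 2 * (f - circ_const (1/2) * (p + q)) = (f - p) + (f - q)"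
    by (simp add: right_diff_distrib) (simp add: two algebra_simps)
  then have "4 * (norm2 (f - circ_const (1/2) * (p + q)))\<^sup>2 = (norm2 ((f - p) + (f - q)))\<^sup>2"
    using norm2_cmult_square[of 2 "f - circ_const (1/2) * (p + q)"] by simp
  moreover have "p - q = (f - q) - (f - p)" by simp
  ultimately show ?thesis
    using assms ip_commute[of "f - p" "f - q"]
    by (simp only: norm2_add_square norm2_diff_square[of "f - q" "f - p"] L2_diff) simp
qed

section \<open>Orthogonal projections\<close>

lemma riesz_fischer_fast_Cauchy:
  assumes X: "\<And>n. X n \<in> L2"
    and bound: "\<And>m n. n \<le> m \<Longrightarrow> (norm2 (X m - X n))\<^sup>2 \<le> (1/4) ^ n"
  obtains G where "G \<in> L2" and "(\<lambda>n. norm2 (X n - G)) \<longlonglongrightarrow> 0"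
proof -
  have "\<forall>n. \<exists>F. F \<in> borel_measurable borel \<and> X n = abs_circ_fun F"
    by (metis circ_fun_representative)
  then obtain F where F [measurable]: "\<And>n. F n \<in> borel_measurable borel"
    and XF: "\<And>n. X n = abs_circ_fun (F n)" by metis
  have diff: "abs_circ_fun f - abs_circ_fun g = abs_circ_fun (\<lambda>z. f z - g z)"
    if "f \<in> borel_measurable borel" "g \<in> borel_measurable borel" for f g
    using that by (simp add: minus_circ_fun.abs_eq)
  have mem: "abs_circ_fun f \<in> L2 \<longleftrightarrow> integrable circle_measure (\<lambda>z. (cmod (f z))\<^sup>2)"
    if "f \<in> borel_measurable borel" for f
    using that by (simp add: L2_def square_integrable.abs_eq)
  have int: "integrable circle_measure (\<lambda>z. (cmod (F m z - F n z))\<^sup>2)" for m n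
    using L2_diff[OF X[of m] X[of n]] by (simp add: XF diff mem)
  have le: "(\<integral>z. (cmod (F m z - F n z))\<^sup>2 \<partial>circle_measure) \<le> (1/4) ^ n" if "n \<le> m" for m n
    using bound[OF that] by (simp add: XF diff norm2_square_integral)
  obtain G where G [measurable]: "G \<in> borel_measurable borel"
    and intG: "\<And>n. integrable circle_measure (\<lambda>z. (cmod (F n z - G z))\<^sup>2)"
    and leG: "\<And>n. (\<integral>z. (cmod (F n z - G z))\<^sup>2 \<partial>circle_measure) \<le> (1/4) ^ n"
    using fast_Cauchy_square_integrable_limit[of F, OF F int le] by blast
  have "X 0 - abs_circ_fun G \<in> L2" using intG by (simp add: XF diff mem)
  from L2_diff[OF X[of 0] this] have "abs_circ_fun G \<in> L2" by simp
  moreover have "(\<lambda>n. norm2 (X n - abs_circ_fun G)) \<longlonglongrightarrow> 0"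
  proof -
    have "(\<lambda>n. (norm2 (X n - abs_circ_fun G))\<^sup>2) \<longlonglongrightarrow> 0"
    proof (rule tendsto_sandwich[of "\<lambda>_. 0"])
      show "(\<lambda>n. (1/4 :: real) ^ n) \<longlonglongrightarrow> 0" by (rule LIMSEQ_realpow_zero) auto
      show "\<forall>\<^sub>F n in sequentially. (norm2 (X n - abs_circ_fun G))\<^sup>2 \<le> (1/4) ^ n"
        using leG by (simp add: XF diff norm2_square_integral)
    qed auto
    then show ?thesis by simp
  qed
  ultimately show thesis by (rule that)
qed

lemma tendsto_zero_of_square_le:
  fixes a :: "nat \<Rightarrow> complex"
  assumes "\<And>n. (cmod (a n))\<^sup>2 \<le> b n" and "b \<longlonglongrightarrow> 0"
  shows "a \<longlonglongrightarrow> 0"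
proof -
  have "(\<lambda>n. (cmod (a n))\<^sup>2) \<longlonglongrightarrow> 0"
    by (rule tendsto_sandwich[OF _ _ tendsto_const assms(2)]) (use assms(1) in auto)
  then show ?thesis by (simp add: tendsto_norm_zero_iff)
qed

lemma closed_subspace_L2: "closed_subspace M \<Longrightarrow> f \<in> M \<Longrightarrow> f \<in> L2"
  by (auto simp: closed_subspace_def)

lemma closed_subspace_add: "closed_subspace M \<Longrightarrow> f \<in> M \<Longrightarrow> g \<in> M \<Longrightarrow> f + g \<in> M"
  and closed_subspace_cmult: "closed_subspace M \<Longrightarrow> f \<in> M \<Longrightarrow> circ_const c * f \<in> M"
  by (simp_all add: closed_subspace_def)

lemma closed_subspace_diff: "closed_subspace M \<Longrightarrow> f \<in> M \<Longrightarrow> g \<in> M \<Longrightarrow> f - g \<in> M"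
  using closed_subspace_add[of M f "circ_const (-1) * g"] closed_subspace_cmult[of M g "-1"]
  by (simp add: circ_const_minus_one)

text \<open>Near-minimizers of the distance from \<open>f\<close> form a Cauchy sequence by the parallelogram law. The
  orthogonality of the residual of the limit is obtained as a limit of the near-orthogonality of
  the residuals of the sequence.\<close>

lemma projection_exists:
  assumes M: "closed_subspace M" and f: "f \<in> L2"
  obtains g where "g \<in> M" and "\<And>k. k \<in> M \<Longrightarrow> ip (f - g) k = 0"
proof -
  define d where "d = (INF g\<in>M. (norm2 (f - g))\<^sup>2)"
  have L2: "g \<in> L2" if "g \<in> M" for g using M that by (rule closed_subspace_L2)
  have M0: "0 \<in> M" using M by (simp add: closed_subspace_def)
  have bdd: "bdd_below ((\<lambda>g. (norm2 (f - g))\<^sup>2) ` M)" by (rule bdd_belowI[of _ 0]) auto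
  have d_le: "d \<le> (norm2 (f - g))\<^sup>2" if "g \<in> M" for g
    unfolding d_def using bdd that by (rule cINF_lower)
  \<comment> \<open>The slack is scaled so that the parallelogram law gives exactly the geometric Cauchy rate.\<close>
  have "\<exists>g\<in>M. (norm2 (f - g))\<^sup>2 < d + (1/4) ^ n / 4" for n :: nat
    using cINF_less_iff[OF _ bdd, of "d + (1/4) ^ n / 4"] M0 by (auto simp: d_def[symmetric])
  then obtain X where X: "\<And>n. X n \<in> M"
    and near: "\<And>n :: nat. (norm2 (f - X n))\<^sup>2 < d + (1/4) ^ n / 4" by metis
  have cauchy: "(norm2 (X m - X n))\<^sup>2 \<le> (1/4) ^ n" if "n \<le> m" for m n
  proof -
    have "circ_const (1/2) * (X m + X n) \<in> M"
      using M X by (intro closed_subspace_cmult closed_subspace_add)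
    from d_le[OF this] have "(norm2 (X m - X n))\<^sup>2
        \<le> 2 * (norm2 (f - X m))\<^sup>2 + 2 * (norm2 (f - X n))\<^sup>2 - 4 * d"
      unfolding parallelogram_midpoint[OF f L2[OF X] L2[OF X]] by simp
    moreover have "(1/4 :: real) ^ m \<le> (1/4) ^ n" using that by (intro power_decreasing) auto
    ultimately show ?thesis using near[of m] near[of n] by linarith
  qed
  obtain g where g: "g \<in> L2" and lim: "(\<lambda>n. norm2 (X n - g)) \<longlonglongrightarrow> 0"
    using riesz_fischer_fast_Cauchy[of X] cauchy L2[OF X] by blast
  have gM: "g \<in> M" using M g X lim unfolding closed_subspace_def by blast
  have "ip (f - g) k = 0" if k: "k \<in> M" for k
  proof -
    have first: "(\<lambda>n. ip (f - X n) k) \<longlonglongrightarrow> 0"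
    proof -
      have "(cmod (ip (f - X n) k))\<^sup>2 \<le> (1/4) ^ n * (norm2 k)\<^sup>2" for n
      proof -
        have "d \<le> (norm2 (f - X n - circ_const c * k))\<^sup>2" for c
          using d_le[of "X n + circ_const c * k"] M X k
          by (simp add: closed_subspace_add closed_subspace_cmult diff_diff_eq)
        then have "(cmod (ip (f - X n) k))\<^sup>2 \<le> ((norm2 (f - X n))\<^sup>2 - d) * (norm2 k)\<^sup>2"
          using f L2[OF X] L2[OF k] by (intro ip_square_le_of_distance L2_diff)
        also have "\<dots> \<le> (1/4) ^ n * (norm2 k)\<^sup>2"
        proof (rule mult_right_mono)
          have "(0 :: real) \<le> (1/4) ^ n" by simp
          then show "(norm2 (f - X n))\<^sup>2 - d \<le> (1/4) ^ n" using near[of n] by linarith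
        qed simp
        finally show ?thesis .
      qed
      moreover have "(\<lambda>n. (1/4 :: real) ^ n * (norm2 k)\<^sup>2) \<longlonglongrightarrow> 0"
        by (intro tendsto_mult_left_zero LIMSEQ_realpow_zero) auto
      ultimately show ?thesis by (rule tendsto_zero_of_square_le)
    qed
    have "(\<lambda>n. ip (X n - g) k) \<longlonglongrightarrow> 0"
    proof -
      have "(\<lambda>n. (norm2 (X n - g))\<^sup>2 * (norm2 k)\<^sup>2) \<longlonglongrightarrow> 0"
        using tendsto_mult_left_zero[of "\<lambda>n. (norm2 (X n - g))\<^sup>2"] lim by simp
      with cauchy_schwarz[OF L2_diff[OF L2[OF X] g] L2[OF k]] show ?thesis
        by (rule tendsto_zero_of_square_le)
    qed
    from tendsto_add[OF first this]
    have "(\<lambda>n. ip (f - X n) k + ip (X n - g) k) \<longlonglongrightarrow> 0" by simp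
    moreover have "ip (f - X n) k + ip (X n - g) k = ip (f - g) k" for n
      using f g L2[OF X] L2[OF k] by (simp add: ip_diff_left)
    ultimately show ?thesis by (simp add: LIMSEQ_const_iff)
  qed
  with gM show thesis by (rule that)
qed

lemma ip_self_eq_zero:
  assumes "f \<in> L2" "ip f f = 0"
  shows "f = 0"
proof -
  obtain F where F [measurable]: "F \<in> borel_measurable borel" and f: "f = abs_circ_fun F"
    by (rule circ_fun_representative)
  have "integrable circle_measure (\<lambda>z. (cmod (F z))\<^sup>2)"
    using assms(1) by (simp add: f L2_def square_integrable.abs_eq)
  moreover have "(\<integral>z. (cmod (F z))\<^sup>2 \<partial>circle_measure) = 0"
    using assms(2) by (simp add: f ip_self_integral)
  ultimately have "AE z in circle_measure. (cmod (F z))\<^sup>2 = 0"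
    by (subst (asm) integral_nonneg_eq_0_iff_AE) auto
  then have "AE z in circle_measure. F z = 0" by simp
  then show ?thesis
    unfolding f zero_circ_fun_def by (intro Quotient_rel_abs[OF Quotient_circ_fun]) simp
qed

text \<open>The description that defines \<^const>\<open>orth_proj\<close> has at most one solution, because the difference of two
  solutions is orthogonal to itself. Hence every projection below is computed by exhibiting it.\<close>

lemma orth_proj_eqI:
  assumes sub: "M \<subseteq> L2" "\<And>a b. a \<in> M \<Longrightarrow> b \<in> M \<Longrightarrow> a - b \<in> M"
    and f: "f \<in> L2" and g: "g \<in> M" "\<And>k. k \<in> M \<Longrightarrow> ip (f - g) k = 0"
  shows "orth_proj M f = g"
  unfolding orth_proj_def
proof (rule the_equality)
  fix g' assume g': "g' \<in> M \<and> (\<forall>k\<in>M. ip (f - g') k = 0)"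
  have mem: "g' - g \<in> M" using sub g g' by blast
  have "g' - g = (f - g) - (f - g')" by simp
  moreover have "ip ((f - g) - (f - g')) (g' - g) = 0"
    using g g' mem sub f by (subst ip_diff_left) (auto intro: L2_diff)
  ultimately have "ip (g' - g) (g' - g) = 0" by simp
  then show "g' = g" using ip_self_eq_zero[of "g' - g"] mem sub by auto
qed (use g in blast)

section \<open>Multiplication by a unimodular function\<close>

lemma unimodular_Linf: "unimodular h \<Longrightarrow> h \<in> Linf"
  unfolding Linf_def mem_Collect_eq
proof (transfer, elim conjE)
  fix h :: "complex \<Rightarrow> complex"
  assume "AE z in circle_measure. cmod (h z) = 1"
  then have "AE z in circle_measure. cmod (h z) \<le> 1" by eventually_elim simp
  then show "\<exists>C. AE z in circle_measure. cmod (h z) \<le> C" ..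
qed

lemma ip_mult_unimodular:
  assumes "unimodular h"
  shows "ip (h * f) (h * g) = ip f g"
  using assms
proof (transfer, elim conjE)
  fix h f g :: "complex \<Rightarrow> complex"
  assume [measurable]: "h \<in> borel_measurable circle_measure" "f \<in> borel_measurable circle_measure"
    "g \<in> borel_measurable circle_measure"
    and h: "AE z in circle_measure. cmod (h z) = 1"
  have "AE z in circle_measure. h z * f z * cnj (h z * g z) = f z * cnj (g z)"
    using h
  proof eventually_elim
    case (elim z)
    have "h z * f z * cnj (h z * g z) = (h z * cnj (h z)) * (f z * cnj (g z))"
      by (simp only: mult_ac complex_cnj_mult)
    also have "h z * cnj (h z) = 1" using complex_norm_square[of "h z"] elim by simp
    finally show ?case by simp
  qed
  then show "(\<integral>z. h z * f z * cnj (h z * g z) \<partial>circle_measure)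
      = (\<integral>z. f z * cnj (g z) \<partial>circle_measure)"
    by (intro integral_cong_AE) measurable
qed

lemma mult_circ_divide_unimodular:
  assumes "unimodular h"
  shows "h * circ_divide f h = f"
  using assms
proof (transfer, elim conjE, intro conjI)
  fix h f :: "complex \<Rightarrow> complex"
  assume [measurable]: "h \<in> borel_measurable circle_measure" "f \<in> borel_measurable circle_measure"
  show "(\<lambda>z. h z * (f z / h z)) \<in> borel_measurable circle_measure" by measurable
  assume "AE z in circle_measure. cmod (h z) = 1"
  then show "AE z in circle_measure. h z * (f z / h z) = f z" by eventually_elim auto
qed

lemma L2_circ_divide_unimodular:
  assumes "unimodular h" "f \<in> L2"
  shows "circ_divide f h \<in> L2"
  using assms unfolding L2_def mem_Collect_eq
proof (transfer, elim conjE)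
  fix h f :: "complex \<Rightarrow> complex"
  assume [measurable]: "h \<in> borel_measurable circle_measure" "f \<in> borel_measurable circle_measure"
    and h: "AE z in circle_measure. cmod (h z) = 1"
    and f: "integrable circle_measure (\<lambda>z. (cmod (f z))\<^sup>2)"
  have "AE z in circle_measure. (cmod (f z))\<^sup>2 = (cmod (f z / h z))\<^sup>2"
    using h by eventually_elim (simp add: norm_divide)
  then show "integrable circle_measure (\<lambda>z. (cmod (f z / h z))\<^sup>2)"
    using f by (subst (asm) integrable_cong_AE) auto
qed

lemma mult_unimodular_cancel:
  assumes "unimodular h" "h * f = h * g"
  shows "f = g"
proof -
  have "(circ_divide 1 h * h) * f = (circ_divide 1 h * h) * g"
    using assms(2) by (simp only: mult.assoc)
  then show ?thesis
    using mult_circ_divide_unimodular[OF assms(1), of 1] by (simp add: mult.commute[of _ h])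
qed

section \<open>Isometric multipliers on negative powers\<close>

lift_definition circ_monomial :: "int \<Rightarrow> circ_fun" is "\<lambda>n z. z powi n" by simp

lemma circ_monomial_L2: "circ_monomial n \<in> L2"
  unfolding L2_def mem_Collect_eq
proof transfer
  fix n
  show "integrable circle_measure (\<lambda>z. (cmod (z powi n))\<^sup>2)"
  proof (rule integrable_circle_bounded[of _ 1])
    show "AE z in circle_measure. norm ((cmod (z powi n))\<^sup>2) \<le> 1"
      using AE_circle_measure_norm by eventually_elim (simp add: norm_power_int)
  qed measurable
qed

lemma cnj_powi: "cmod z = 1 \<Longrightarrow> cnj z powi n = z powi (- n)"
  by (simp add: cnj_eq_inverse power_int_inverse power_int_minus)

lemma fourier_eq_ip: "fourier f n = ip f (circ_monomial n)"
proof transfer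
  fix f :: "complex \<Rightarrow> complex" and n
  assume "f \<in> borel_measurable circle_measure \<and> f \<in> borel_measurable circle_measure
     \<and> (AE z in circle_measure. f z = f z)"
  then have [measurable]: "f \<in> borel_measurable borel" by simp
  have "AE z in circle_measure. f z * z powi (- n) = f z * cnj (z powi n)"
    using AE_circle_measure_norm by eventually_elim (simp add: cnj_powi)
  then show "(\<integral>z. f z * z powi (- n) \<partial>circle_measure) = (\<integral>z. f z * cnj (z powi n) \<partial>circle_measure)"
    by (intro integral_cong_AE) measurable
qed

lemma circ_monomial_orthogonal_H2:
  assumes "A \<subseteq> H2" "n < 0"
  shows "circ_monomial n \<in> L2 \<ominus> A"
proof -
  have "ip (circ_monomial n) g = 0" if "g \<in> A" for g
  proof -
    have "ip g (circ_monomial n) = 0"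
      using that assms by (auto simp: H2_def fourier_eq_ip)
    then show ?thesis by (subst ip_commute) simp
  qed
  then show ?thesis by (simp add: ominus_def circ_monomial_L2)
qed

text \<open>For \<open>m, n < 0\<close> the assumption says \<open>\<integral> \<bar>h\<bar>\<^sup>2 z\<^sup>m\<^sup>-\<^sup>n = \<integral> z\<^sup>m\<^sup>-\<^sup>n\<close>. Every integer is a difference of
  two negative ones, so all Fourier coefficients of \<open>\<bar>h\<bar>\<^sup>2 - 1\<close> vanish.\<close>

lemma unimodular_if_isometric_on_monomials:
  assumes h: "h \<in> L2"
    and iso: "\<And>m n. m < 0 \<Longrightarrow> n < 0 \<Longrightarrow>
      ip (h * circ_monomial m) (h * circ_monomial n) = ip (circ_monomial m) (circ_monomial n)"
  shows "unimodular h"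
proof -
  obtain H where H [measurable]: "H \<in> borel_measurable borel" and hH: "h = abs_circ_fun H"
    by (rule circ_fun_representative)
  define w where "w = (\<lambda>z. (cmod (H z))\<^sup>2 - 1)"
  have sq: "integrable circle_measure (\<lambda>z. (cmod (H z))\<^sup>2)"
    using h by (simp add: hH L2_def square_integrable.abs_eq)
  have one: "integrable circle_measure (\<lambda>_. 1 :: real)"
    by (rule integrable_circle_bounded[of _ 1]) auto
  have one_c: "integrable circle_measure (\<lambda>_. 1 :: complex)"
    by (rule integrable_circle_bounded[of _ 1]) auto
  have "all_fourier_zero (\<lambda>z. complex_of_real (w z))"
    unfolding all_fourier_zero_def
  proof (intro conjI allI)
    show "integrable circle_measure (\<lambda>z. complex_of_real (w z))"
      unfolding complex_of_real_integrable_eq w_def using sq one by simp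
    fix k :: int
    define m n where "m = - 1 - \<bar>k\<bar> + k" and "n = - 1 - \<bar>k\<bar>"
    have mn: "m < 0" "n < 0" "m - n = k" by (auto simp: m_def n_def)
    have prod: "z powi m * cnj (z powi n) = z powi k" if "cmod z = 1" for z
    proof -
      have "z \<noteq> 0" using that by auto
      then show ?thesis
        using power_int_add[of z m "- n"] mn(3) by (simp add: cnj_powi that)
    qed
    have "(\<integral>z. complex_of_real ((cmod (H z))\<^sup>2) * z powi k \<partial>circle_measure)
        = (\<integral>z. (H z * z powi m) * cnj (H z * z powi n) \<partial>circle_measure)"
    proof (rule integral_cong_AE)
      show "AE z in circle_measure. complex_of_real ((cmod (H z))\<^sup>2) * z powi k
          = (H z * z powi m) * cnj (H z * z powi n)"
        using AE_circle_measure_norm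
      proof eventually_elim
        case (elim z)
        show ?case
          by (simp only: complex_norm_square prod[OF elim, symmetric] complex_cnj_mult mult_ac)
      qed
    qed measurable
    also have "\<dots> = ip (h * circ_monomial m) (h * circ_monomial n)"
      by (simp add: hH circ_monomial.abs_eq times_circ_fun.abs_eq ip.abs_eq)
    also have "\<dots> = (\<integral>z. z powi m * cnj (z powi n) \<partial>circle_measure)"
      using iso[OF mn(1,2)] by (simp add: circ_monomial.abs_eq ip.abs_eq)
    also have "\<dots> = (\<integral>z. z powi k \<partial>circle_measure)"
    proof (rule integral_cong_AE)
      show "AE z in circle_measure. z powi m * cnj (z powi n) = z powi k"
        using AE_circle_measure_norm by eventually_elim (rule prod)
    qed measurable
    finally have eq: "(\<integral>z. complex_of_real ((cmod (H z))\<^sup>2) * z powi k \<partial>circle_measure)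
      = (\<integral>z. z powi k \<partial>circle_measure)" .
    have "integrable circle_measure (\<lambda>z. complex_of_real ((cmod (H z))\<^sup>2) * z powi k)"
      by (intro integrable_mult_powi) (use sq in \<open>simp only: complex_of_real_integrable_eq\<close>)
    moreover have "integrable circle_measure (\<lambda>z. z powi k)"
      using integrable_mult_powi[OF one_c, of k] by simp
    moreover have "complex_of_real (w z) * z powi k
        = complex_of_real ((cmod (H z))\<^sup>2) * z powi k - z powi k" for z
      by (simp add: w_def left_diff_distrib)
    ultimately show "(\<integral>z. complex_of_real (w z) * z powi k \<partial>circle_measure) = 0"
      using eq by simp
  qed
  then have "AE z in circle_measure. w z = 0" by (rule fourier_uniqueness_real)
  then have "AE z in circle_measure. cmod (H z) = 1"
  proof eventually_elim
    case (elim z)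
    then have "(cmod (H z))\<^sup>2 = 1\<^sup>2" by (simp add: w_def)
    then show ?case by (rule power2_eq_imp_eq) simp_all
  qed
  then show ?thesis by (simp add: hH unimodular.abs_eq)
qed

section \<open>Unitary multiplication between orthogonal complements\<close>

lemma ominus_L2_diff:
  assumes "M \<subseteq> L2" "a \<in> L2 \<ominus> M" "b \<in> L2 \<ominus> M"
  shows "a - b \<in> L2 \<ominus> M"
  using assms by (auto simp: ominus_def L2_diff ip_diff_left subset_iff)

lemma mult_unimodular_image_complement:
  assumes h: "unimodular h" and K: "(*) h ` K = M" and f: "f \<in> L2"
  shows "h * f \<in> L2 \<ominus> M \<longleftrightarrow> f \<in> L2 \<ominus> K"
proof -
  have "h * f \<in> L2" using unimodular_Linf[OF h] f by (rule L2_mult_Linf)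
  then show ?thesis
    using f by (auto simp: ominus_def K[symmetric] ip_mult_unimodular[OF h])
qed

text \<open>Multiplication by \<open>h\<close> is unitary on all of \<open>L\<^sup>2\<close>, with inverse division by \<open>h\<close>; a unitary that maps
  \<open>K\<close> onto \<open>M\<close> maps the complement of \<open>K\<close> onto the complement of \<open>M\<close>.\<close>

lemma unitary_op_mult_unimodular:
  assumes h: "unimodular h" and K: "(*) h ` K = M" and K_L2: "K \<subseteq> L2"
  shows "unitary_op (L2 \<ominus> K) (L2 \<ominus> M) (\<lambda>f \<in> L2 \<ominus> K. h * f)"
  unfolding unitary_op_def
proof (intro conjI ballI)
  have L2: "f \<in> L2" if "f \<in> L2 \<ominus> A" for f A using that by (simp add: ominus_def)
  have add: "f + g \<in> L2 \<ominus> K" if "f \<in> L2 \<ominus> K" "g \<in> L2 \<ominus> K" for f g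
    using that K_L2 by (auto simp: ominus_def L2_add ip_add_left subset_iff)
  have cmult: "circ_const c * f \<in> L2 \<ominus> K" if "f \<in> L2 \<ominus> K" for f c
    using that by (auto simp: ominus_def L2_cmult ip_cmult_left)
  show "linear_on_set (L2 \<ominus> K) (\<lambda>f \<in> L2 \<ominus> K. h * f)"
    by (simp add: linear_on_set_def add cmult distrib_left mult.left_commute)
  show "bij_betw (\<lambda>f \<in> L2 \<ominus> K. h * f) (L2 \<ominus> K) (L2 \<ominus> M)"
  proof (rule bij_betw_imageI)
    show "inj_on (\<lambda>f \<in> L2 \<ominus> K. h * f) (L2 \<ominus> K)"
      using mult_unimodular_cancel[OF h] by (auto simp: inj_on_def)
    show "(\<lambda>f \<in> L2 \<ominus> K. h * f) ` (L2 \<ominus> K) = L2 \<ominus> M"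
    proof (intro equalityI subsetI)
      fix g assume "g \<in> (\<lambda>f \<in> L2 \<ominus> K. h * f) ` (L2 \<ominus> K)"
      then show "g \<in> L2 \<ominus> M"
        using mult_unimodular_image_complement[OF h K] L2 by auto
    next
      fix g assume g: "g \<in> L2 \<ominus> M"
      define f where "f = circ_divide g h"
      have gf: "g = h * f" by (simp add: f_def mult_circ_divide_unimodular[OF h])
      have "f \<in> L2" unfolding f_def using h L2[OF g] by (rule L2_circ_divide_unimodular)
      then have "f \<in> L2 \<ominus> K"
        using g mult_unimodular_image_complement[OF h K] by (simp add: gf)
      then show "g \<in> (\<lambda>f \<in> L2 \<ominus> K. h * f) ` (L2 \<ominus> K)" by (auto simp: gf)
    qed
  qed
  show "ip ((\<lambda>f \<in> L2 \<ominus> K. h * f) f) ((\<lambda>f \<in> L2 \<ominus> K. h * f) g) = ip f g"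
    if "f \<in> L2 \<ominus> K" "g \<in> L2 \<ominus> K" for f g
    using that by (simp add: ip_mult_unimodular[OF h])
qed

text \<open>Conjugation by the unitary multiplication by \<open>h\<close> takes the projection onto \<open>K\<close> to the projection
  onto \<open>M\<close>. Since \<open>M\<close> is closed, the projection of \<open>h f\<close> onto \<open>M\<close> exists, and dividing it
  by \<open>h\<close> produces the projection of \<open>f\<close> onto \<open>K\<close>.\<close>

lemma projection_transport:
  assumes h: "unimodular h" and M: "closed_subspace M" and K: "(*) h ` K = M" and K_L2: "K \<subseteq> L2"
    and f: "f \<in> L2"
  shows "f - orth_proj K f \<in> L2 \<ominus> K"
    and "orth_proj (L2 \<ominus> M) (h * f) = h * (f - orth_proj K f)"
proof -
  have M_L2: "M \<subseteq> L2" using M by (auto simp: closed_subspace_def)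
  have hf: "h * f \<in> L2" using unimodular_Linf[OF h] f by (rule L2_mult_Linf)
  obtain g where g: "g \<in> M" and orth: "\<And>k. k \<in> M \<Longrightarrow> ip (h * f - g) k = 0"
    using projection_exists[OF M hf] by blast
  obtain p where p: "p \<in> K" and gp: "g = h * p" using g K by auto
  have diff_K: "a - b \<in> K" if "a \<in> K" "b \<in> K" for a b
  proof -
    have "h * a - h * b \<in> M" using that K by (intro closed_subspace_diff[OF M]) auto
    then obtain c where "c \<in> K" "h * (a - b) = h * c" using K by (auto simp: right_diff_distrib)
    then show ?thesis using mult_unimodular_cancel[OF h] by metis
  qed
  have proj: "orth_proj K f = p"
  proof (rule orth_proj_eqI[OF K_L2 diff_K f p])
    fix k assume "k \<in> K"
    then have "ip (h * (f - p)) (h * k) = 0"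
      using orth[of "h * k"] K by (auto simp: gp right_diff_distrib)
    then show "ip (f - p) k = 0" by (simp only: ip_mult_unimodular[OF h])
  qed
  have compl: "h * (f - p) \<in> L2 \<ominus> M"
    using orth L2_diff[OF hf] g M_L2 by (auto simp: ominus_def gp right_diff_distrib)
  have "f - p \<in> L2" using f p K_L2 by (auto intro: L2_diff)
  then show "f - orth_proj K f \<in> L2 \<ominus> K"
    using compl mult_unimodular_image_complement[OF h K] by (simp add: proj)
  show "orth_proj (L2 \<ominus> M) (h * f) = h * (f - orth_proj K f)"
    unfolding proj
  proof (rule orth_proj_eqI[OF _ ominus_L2_diff[OF M_L2] hf compl])
    show "L2 \<ominus> M \<subseteq> L2" by (auto simp: ominus_def)
    fix k assume "k \<in> L2 \<ominus> M"
    then have "ip k g = 0" using g by (simp add: ominus_def)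
    then have "ip g k = 0" by (subst ip_commute) simp
    then show "ip (h * f - h * (f - p)) k = 0" by (simp add: gp right_diff_distrib)
  qed
qed

theorem theorem3p6:
  fixes M :: "circ_fun set" and h u :: circ_fun
  assumes "nearly_S_star_invariant M"
    and "M \<noteq> {0}" and "M \<noteq> H2"
    and "extremal_representation M h u"
  shows "((\<forall>f \<in> L2 \<ominus> model_space u. h * f \<in> L2)
            \<and> unitary_op (L2 \<ominus> model_space u) (L2 \<ominus> M) (W_op h u)
          \<longleftrightarrow> is_inner h)
       \<and> (is_inner h \<longrightarrow>
            h \<in> Linf
          \<and> W_op h u = restrict (mult_op h) (L2 \<ominus> model_space u)
          \<and> (\<forall>\<phi>\<in>Linf. \<forall>f \<in> L2 \<ominus> model_space u.
                D_space M \<phi> (W_op h u f) = W_op h u (D_model u \<phi> f))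
          \<and> implements_unitary_equivalence (L2 \<ominus> model_space u) (L2 \<ominus> M) (W_op h u)
              Linf (D_model u) (D_space M))"
proof -
  define K where "K = model_space u"
  have KH: "K \<subseteq> H2" by (auto simp: K_def model_space_def ominus_def)
  then have K_L2: "K \<subseteq> L2" by (auto simp: H2_def)
  have M: "closed_subspace M" and MH: "M \<subseteq> H2"
    using assms(1) by (simp_all add: nearly_S_star_invariant_def)
  have hM: "h \<in> M" and img: "(*) h ` K = M"
    using assms(4) by (simp_all add: extremal_representation_def isometry_onto_def K_def)
  have hH: "h \<in> H2" using hM MH by auto
  have L2I: "f \<in> L2" if "f \<in> L2 \<ominus> A" for f A using that by (simp add: ominus_def)
  have W: "W_op h u = (\<lambda>f \<in> L2 \<ominus> K. h * f)" by (simp add: W_op_def K_def)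
  \<comment> \<open>Negative powers of \<open>z\<close> are orthogonal to \<open>H\<^sup>2\<close>, hence to \<open>K\<close>, so they test the unitarity.\<close>
  have necessity: "is_inner h" if U: "unitary_op (L2 \<ominus> K) (L2 \<ominus> M) (W_op h u)"
  proof -
    have "unimodular h"
    proof (rule unimodular_if_isometric_on_monomials)
      show "h \<in> L2" using hH by (simp add: H2_def)
      fix m n :: int
      assume "m < 0" "n < 0"
      then have "circ_monomial m \<in> L2 \<ominus> K" "circ_monomial n \<in> L2 \<ominus> K"
        using circ_monomial_orthogonal_H2[OF KH] by auto
      then show "ip (h * circ_monomial m) (h * circ_monomial n)
          = ip (circ_monomial m) (circ_monomial n)"
        using U by (auto simp: unitary_op_def W)
    qed
    then show ?thesis using hH by (simp add: is_inner_def)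
  qed
  have sufficiency: "(\<forall>f \<in> L2 \<ominus> K. h * f \<in> L2) \<and> unitary_op (L2 \<ominus> K) (L2 \<ominus> M) (W_op h u)
      \<and> h \<in> Linf
      \<and> W_op h u = restrict (mult_op h) (L2 \<ominus> K)
      \<and> (\<forall>\<phi>\<in>Linf. \<forall>f \<in> L2 \<ominus> K. D_space M \<phi> (W_op h u f) = W_op h u (D_model u \<phi> f))
      \<and> implements_unitary_equivalence (L2 \<ominus> K) (L2 \<ominus> M) (W_op h u)
          Linf (D_model u) (D_space M)"
    if inner: "is_inner h"
  proof -
    have h: "unimodular h" using inner by (simp add: is_inner_def)
    note hL = unimodular_Linf[OF h]
    have U: "unitary_op (L2 \<ominus> K) (L2 \<ominus> M) (W_op h u)"
      unfolding W by (rule unitary_op_mult_unimodular[OF h img K_L2])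
    have W_img: "W_op h u ` (L2 \<ominus> K) = L2 \<ominus> M"
      using U by (simp add: unitary_op_def bij_betw_def)
    have D_in: "D_model u \<phi> f \<in> L2 \<ominus> K" and inter: "D_space M \<phi> (W_op h u f) = W_op h u (D_model u \<phi> f)"
      if \<phi>: "\<phi> \<in> Linf" and f: "f \<in> L2 \<ominus> K" for \<phi> f
    proof -
      have \<phi>f: "\<phi> * f \<in> L2" using \<phi> L2I[OF f] by (rule L2_mult_Linf)
      have D: "D_model u \<phi> f = \<phi> * f - orth_proj K (\<phi> * f)"
        using f by (simp add: D_model_def mult_op_def L2I K_def[symmetric])
      show "D_model u \<phi> f \<in> L2 \<ominus> K"
        unfolding D by (rule projection_transport(1)[OF h M img K_L2 \<phi>f])
      then have "W_op h u (D_model u \<phi> f) = h * (\<phi> * f - orth_proj K (\<phi> * f))"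
        by (simp add: W D)
      moreover have "W_op h u f = h * f" "h * f \<in> L2 \<ominus> M"
        using f W_img by (auto simp: W)
      then have "D_space M \<phi> (W_op h u f) = orth_proj (L2 \<ominus> M) (h * (\<phi> * f))"
        by (simp add: D_space_def mult_op_def L2I mult.left_commute)
      ultimately show "D_space M \<phi> (W_op h u f) = W_op h u (D_model u \<phi> f)"
        by (simp add: projection_transport(2)[OF h M img K_L2 \<phi>f])
    qed
    have "D_space M \<phi> ` (L2 \<ominus> M) \<subseteq> L2 \<ominus> M" if "\<phi> \<in> Linf" for \<phi>
    proof -
      have "D_space M \<phi> (W_op h u f) \<in> L2 \<ominus> M" if "f \<in> L2 \<ominus> K" for f
        using inter[OF \<open>\<phi> \<in> Linf\<close> that] D_in[OF \<open>\<phi> \<in> Linf\<close> that] W_img by auto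
      then show ?thesis by (auto simp: W_img[symmetric])
    qed
    then have "implements_unitary_equivalence (L2 \<ominus> K) (L2 \<ominus> M) (W_op h u)
        Linf (D_model u) (D_space M)"
      using U D_in inter by (auto simp: implements_unitary_equivalence_def)
    moreover have "W_op h u = restrict (mult_op h) (L2 \<ominus> K)"
      by (auto simp: W mult_op_def L2I restrict_def)
    ultimately show ?thesis
      using U hL inter L2_mult_Linf[OF hL L2I] by blast
  qed
  show ?thesis using necessity sufficiency unfolding K_def by blast
qed

end
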